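(* For all positive integers $k,n$, $$\sum_{i=1}^{n}M_i^{(k)}=\frac{2^kM_n^{(k)}-n}{M_k} .$$
   Context: The Mersenne numbers $\{M_n\}_{n\ge 0}$ are defined by $M_0=0$, $M_1=1$, $M_{n+2}=3M_{n+1}-2M_n$, i.e. $M_n=2^n-1$. For a positive integer $k$, the higher order Mersenne numbers are $M_n^{(k)}=M_{kn}/M_k$ for $n=0,1,2,\dots$. *)

theory Defs
  imports Complex_Main
begin

fun mersenne :: "nat \<Rightarrow> int" where
  "mersenne 0 = 0"
| "mersenne (Suc 0) = 1"
| "mersenne (Suc (Suc n)) = 3 * mersenne (Suc n) - 2 * mersenne n"

lemma mersenne_closed_form: "mersenne n = 2 ^ n - 1"
  by (induction n rule: mersenne.induct) simp_all

(* The quotient is an integer, but it is taken in the field of rationals so that no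
   truncating division is involved.  It is only meaningful for k > 0 (M_0 = 0). *)
definition higher_mersenne :: "nat \<Rightarrow> nat \<Rightarrow> rat" where
  "higher_mersenne k n = of_int (mersenne (k * n)) / of_int (mersenne k)"

end

theory Submission
  imports Defs
begin

text \<open>With q = 2^k, the closed form of \<open>mersenne\<close> turns M_i^(k) into (q^i - 1)/(q
  - 1), where q - 1 = M_k does not depend on i. The sum is thus a geometric sum minus n, all over
  M_k; \<open>sum_power_minus_one\<close> evaluates the numerator.\<close>

lemma higher_mersenne_eq: "higher_mersenne k n = ((2 ^ k) ^ n - 1) / (2 ^ k - 1)"
  by (simp add: higher_mersenne_def mersenne_closed_form power_mult)

text \<open>Geometric series from q to q^n, less n ones. The quotient is kept whole because at q =
  2^k it is \<open>higher_mersenne k n\<close>.\<close>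

lemma sum_power_minus_one:
  fixes q :: "'a::field"
  assumes "q \<noteq> 1"
  shows "(\<Sum>i = 1..n. q ^ i - 1) = q * ((q ^ n - 1) / (q - 1)) - of_nat n"
proof (induction n)
  case (Suc n)
  have "q - 1 \<noteq> 0"
    using assms by simp
  then have "q * ((q ^ n - 1) / (q - 1)) + q ^ Suc n = q * ((q ^ Suc n - 1) / (q - 1))"
    by (simp add: field_simps)
  moreover have "(\<Sum>i = 1..Suc n. q ^ i - 1) = (\<Sum>i = 1..n. q ^ i - 1) + (q ^ Suc n - 1)"
    by simp
  ultimately show ?case
    unfolding Suc.IH by (metis add_diff_add of_nat_Suc add.commute)
qed simp

theorem theorem2p17:
  fixes k n :: nat
  assumes "k > 0" and "n > 0"
  shows "(\<Sum>i = 1..n. higher_mersenne k i)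
    = (2 ^ k * higher_mersenne k n - of_nat n) / of_int (mersenne k)"
proof -
  have "(2 :: rat) ^ k \<noteq> 1"
    using one_less_power[of "2 :: rat" k] assms(1) by fastforce
  from sum_power_minus_one[OF this, of n] show ?thesis
    \<comment> \<open>The flipped rule pulls the common denominator M_k out of the sum, exposing the
      numerator just evaluated.\<close>
    by (simp add: higher_mersenne_eq mersenne_closed_form flip: sum_divide_distrib)
qed

end
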